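(* Let $n\geq 5$ be odd. Let $D$ be the distance matrix of the wheel graph with $n$ vertices. Let $a=(0,-1,1,\ldots,-1,1)\in\mathbb{R}^n$ and $v=(1,-1,\ldots,1,-1)\in\mathbb{R}^{n-1}$. Let $z=(z(0),\ldots,z(n-2))\in\mathbb{R}^{n-1}$ be given by $$z(0)=\frac{-n^{3}+3n^{2}+n+9}{12},$$ for $1\leq k\leq\frac{n-3}{2}$, $$z(k)=z(n-1-k)=\begin{cases}\dfrac{-6(n-1)k^{2}+6(n-1)^{2}k-n^{3}+3n^{2}+n+9}{12}, & k\text{ even},\\[2mm] \dfrac{6(n-1)k^{2}-6(n-1)^{2}k+n^{3}-3n^{2}+5n-15}{12}, & k\text{ odd},\end{cases}$$ and $$z\left(\tfrac{n-1}{2}\right)=\begin{cases}\dfrac{n^{3}-3n^{2}+11n+15}{24}, & n=5+4m,\ m=0,1,\ldots,\\[2mm] \dfrac{-n^{3}+3n^{2}+n-27}{24}, & n=7+4m,\ m=0,1,\ldots.\end{cases}$$ Then $D+aa^{t}$ is invertible, $$(D+aa^{t})^{-1}=\frac{1}{(n-1)^{2}}\begin{pmatrix}-2(n-1)(n-3) & (n-1)e^{t}\\ (n-1)e & \mathrm{circ}(z)\end{pmatrix}$$ and $$D^{\dagger}=\frac{1}{(n-1)^{2}}\begin{pmatrix}-2(n-1)(n-3) & (n-1)e^{t}\\ (n-1)e & \mathrm{circ}(z-v)\end{pmatrix}.$$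
   Context: The wheel graph $W(n)$ has center labeled $1$, adjacent to all other vertices, and the vertices $2,\ldots,n$ form a cycle of length $n-1$ in that order. Its distance matrix is $D=\begin{pmatrix}0&e^{t}\\ e&\mathrm{circ}(u)\end{pmatrix}$ with $u=(0,1,2,\ldots,2,1)\in\mathbb{R}^{n-1}$. For a vector $c$ of length $N$, $\mathrm{circ}(c)$ is the $N\times N$ circulant matrix whose first row is $c$ and each of whose subsequent rows is the cyclic right shift by one of the previous row. Vectors are regarded as column vectors; in the block matrices $e$ is the vector in $\mathbb{R}^{n-1}$ with all components $1$; $t$ denotes transpose. $D^{\dagger}$ is the Moore--Penrose inverse: the unique matrix $X$ with $DXD=D$, $XDX=X$, $(DX)^{t}=DX$, $(XD)^{t}=XD$. *)

theory Defs
  imports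
    "Jordan_Normal_Form.Matrix"
    "Graph_Theory.Graph_Theory"
begin

text \<open>Undirected graphs are represented, as in \<open>Graph_Theory\<close>, by symmetric digraphs.\<close>

definition wheel :: "nat \<Rightarrow> nat pair_pre_digraph" where
  "wheel n = mk_symmetric
     \<lparr> pverts = {1..n},
       parcs = {(1, i) |i. i \<in> {2..n}} \<union> {(i, i + 1) |i. i \<in> {2..<n}} \<union> {(n, 2)} \<rparr>"

lemma wheel_simps:
  "pverts (wheel n) = {1..n}"
  "parcs (wheel n) =
     (\<Union>i\<in>{2..n}. {(1, i), (i, 1)}) \<union> (\<Union>i\<in>{2..<n}. {(i, i + 1), (i + 1, i)}) \<union> {(n, 2), (2, n)}"
  unfolding wheel_def mk_symmetric_def by auto

lemma pair_graph_wheel: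
  assumes "3 \<le> n"
  shows "pair_graph (wheel n)"
proof unfold_locales
  have "sym (arcs_ends (with_proj (wheel n)))"
    by (rule symI) (auto simp: wheel_simps)
  then show "symmetric (with_proj (wheel n))"
    by (simp add: symmetric_def)
qed (use assms in \<open>auto simp: wheel_simps\<close>)

text \<open>Path length is unit-weight cost, so the distance is \<open>wf_digraph.\<mu>\<close> for the weight 1.\<close>

definition graph_dist :: "'a pair_pre_digraph \<Rightarrow> 'a \<Rightarrow> 'a \<Rightarrow> real" where
  "graph_dist G u v = real_of_ereal (wf_digraph.\<mu> (with_proj G) (\<lambda>_. 1) u v)"

text \<open>Vertices are labelled from 1, matrix indices start at 0.\<close>

definition distance_matrix :: "nat \<Rightarrow> nat pair_pre_digraph \<Rightarrow> real mat" where
  "distance_matrix n G = mat n n (\<lambda>(i, j). graph_dist G (i + 1) (j + 1))"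

definition shift_right :: "'a vec \<Rightarrow> 'a vec" where
  "shift_right c = vec (dim_vec c) (\<lambda>j. if j = 0 then c $ (dim_vec c - 1) else c $ (j - 1))"

definition circ :: "'a vec \<Rightarrow> 'a mat" where
  "circ c = mat_of_rows (dim_vec c) (map (\<lambda>i. (shift_right ^^ i) c) [0..<dim_vec c])"

lemma dim_vec_shift_right_pow [simp]: "dim_vec ((shift_right ^^ i) c) = dim_vec c"
  by (induction i) (auto simp: shift_right_def)

lemma dim_circ [simp]: "dim_row (circ c) = dim_vec c" "dim_col (circ c) = dim_vec c"
  by (simp_all add: circ_def)

lemma shift_right_pow_index:
  assumes "j < dim_vec c" "i \<le> dim_vec c"
  shows "(shift_right ^^ i) c $ j = c $ ((j + dim_vec c - i) mod dim_vec c)"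
  using assms
proof (induction i arbitrary: j)
  case 0
  then show ?case by simp
next
  case (Suc i)
  let ?N = "dim_vec c"
  show ?case
  proof (cases "j = 0")
    case True
    have "(shift_right ^^ Suc i) c $ j = (shift_right ^^ i) c $ (?N - 1)"
      using Suc.prems True by (simp add: shift_right_def)
    also have "\<dots> = c $ ((?N - 1 + ?N - i) mod ?N)"
      using Suc.prems by (intro Suc.IH) auto
    also have "?N - 1 + ?N - i = (?N - Suc i) + ?N"
      using Suc.prems by simp
    finally show ?thesis
      using True by simp
  next
    case False
    have "(shift_right ^^ Suc i) c $ j = (shift_right ^^ i) c $ (j - 1)"
      using Suc.prems False by (simp add: shift_right_def)
    also have "\<dots> = c $ ((j - 1 + ?N - i) mod ?N)"
      using Suc.prems by (intro Suc.IH) auto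
    also have "j - 1 + ?N - i = j + ?N - Suc i"
      using False Suc.prems by simp
    finally show ?thesis .
  qed
qed

lemma circ_index:
  assumes "i < dim_vec c" "j < dim_vec c"
  shows "circ c $$ (i, j) = c $ ((j + dim_vec c - i) mod dim_vec c)"
  using assms by (simp add: circ_def mat_of_rows_index shift_right_pow_index)

definition col_mat :: "'a vec \<Rightarrow> 'a mat" where
  "col_mat x = mat_of_cols (dim_vec x) [x]"

definition ones_vec :: "nat \<Rightarrow> real vec" where
  "ones_vec m = vec m (\<lambda>_. 1)"

definition bordered_mat :: "real \<Rightarrow> real \<Rightarrow> real mat \<Rightarrow> real mat" where
  "bordered_mat \<alpha> \<beta> C =
     four_block_mat
       (mat 1 1 (\<lambda>_. \<alpha>)) (\<beta> \<cdot>\<^sub>m transpose_mat (col_mat (ones_vec (dim_row C))))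
       (\<beta> \<cdot>\<^sub>m col_mat (ones_vec (dim_row C))) C"

lemma (in pair_wf_digraph) graph_dist_le_2:
  assumes uv: "u \<in> pverts G" and w: "(u, w) \<in> parcs G" "(w, v) \<in> parcs G"
  shows "graph_dist G u v = (if u = v then 0 else if (u, v) \<in> parcs G then 1 else 2)"
proof -
  have cost: "awalk_cost (\<lambda>_. 1) p = real (length p)" for p
    by (induction p) auto
  have v: "v \<in> pverts G" "w \<in> pverts G"
    using w by (auto dest: in_arcsD1 in_arcsD2)
  let ?d = "if u = v then 0 else if (u, v) \<in> parcs G then 1 else (2::nat)"
  have "\<mu> (\<lambda>_. 1) u v = ereal (real ?d)"
  proof (rule antisym)
    have "awalk u [] u" "(u, v) \<in> parcs G \<Longrightarrow> awalk u [(u, v)] v" "awalk u [(u, w), (w, v)] v"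
      using uv v w by (auto simp: awalk_simps)
    then have "awalk u (if u = v then [] else if (u, v) \<in> parcs G then [(u, v)] else [(u, w), (w, v)]) v"
      (is "awalk u ?p v")
      by auto
    moreover have "length ?p = ?d"
      by simp
    ultimately show "\<mu> (\<lambda>_. 1) u v \<le> ereal (real ?d)"
      using min_cost_le_walk_cost[of u ?p v "\<lambda>_. 1"] by (simp only: cost)
    have "?d \<le> length p" if "awalk u p v" for p
    proof (cases p)
      case Nil
      then show ?thesis
        using that by (simp add: awalk_simps)
    next
      case (Cons e es)
      then show ?thesis
        using that by (cases es) (auto simp: awalk_simps)
    qed
    then show "ereal (real ?d) \<le> \<mu> (\<lambda>_. 1) u v"
      unfolding \<mu>_def cost by (intro INF_greatest) (simp only: ereal_less_eq of_nat_le_iff mem_Collect_eq)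
  qed
  then show ?thesis
    by (simp add: graph_dist_def)
qed

lemma graph_dist_wheel:
  assumes "3 \<le> n" "u \<in> {1..n}" "v \<in> {1..n}"
  shows "graph_dist (wheel n) u v =
    (if u = v then 0 else if (u, v) \<in> parcs (wheel n) then 1 else 2)"
proof -
  have wf: "pair_wf_digraph (wheel n)"
    using assms(1) by unfold_locales (auto simp: wheel_simps)
  show ?thesis
  proof (cases "u = v \<or> u \<noteq> 1 \<and> v \<noteq> 1")
    case True
    define w where "w = (if u = 1 then 2 else 1 :: nat)"
    have "(u, w) \<in> parcs (wheel n)" "(w, v) \<in> parcs (wheel n)"
      using True assms by (auto simp: wheel_simps w_def)
    then show ?thesis
      using assms by (intro pair_wf_digraph.graph_dist_le_2[OF wf]) (auto simp: wheel_simps(1))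
  next
    case False
    define w where "w = (if (if u = 1 then v else u) = n then 2 else (if u = 1 then v else u) + 1)"
    have w: "(u, w) \<in> parcs (wheel n)" "(w, v) \<in> parcs (wheel n)"
      using False assms by (auto simp: wheel_simps w_def)
    then show ?thesis
      using assms by (intro pair_wf_digraph.graph_dist_le_2[OF wf _ w]) (auto simp: wheel_simps(1))
  qed
qed

lemma dim_bordered_mat [simp]:
  "dim_row (bordered_mat \<alpha> \<beta> C) = Suc (dim_row C)" "dim_col (bordered_mat \<alpha> \<beta> C) = Suc (dim_col C)"
  by (simp_all add: bordered_mat_def)

lemma bordered_mat_index:
  assumes "i \<le> dim_row C" "j \<le> dim_row C" "dim_col C = dim_row C"
  shows "bordered_mat \<alpha> \<beta> C $$ (i, j) =
    (if i = 0 \<and> j = 0 then \<alpha> else if i = 0 \<or> j = 0 then \<beta> else C $$ (i - 1, j - 1))"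
  using assms
  by (auto simp: bordered_mat_def col_mat_def ones_vec_def mat_of_cols_index)

lemma distance_matrix_wheel:
  assumes "5 \<le> n"
  shows "distance_matrix n (wheel n) =
    bordered_mat 0 1 (circ (vec (n - 1) (\<lambda>i. if i = 0 then 0 else if i = 1 \<or> i = n - 2 then 1 else 2)))"
    (is "_ = bordered_mat 0 1 (circ ?u)")
proof (rule eq_matI)
  fix i j
  assume "i < dim_row (bordered_mat 0 1 (circ ?u))" "j < dim_col (bordered_mat 0 1 (circ ?u))"
  then have ij: "i < n" "j < n"
    using assms by auto
  have lhs: "distance_matrix n (wheel n) $$ (i, j) =
      (if i = j then 0 else if (i + 1, j + 1) \<in> parcs (wheel n) then 1 else 2)"
    using ij assms by (simp add: distance_matrix_def graph_dist_wheel)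
  show "distance_matrix n (wheel n) $$ (i, j) = bordered_mat 0 1 (circ ?u) $$ (i, j)"
  proof (cases "i = 0 \<or> j = 0")
    case True
    then show ?thesis
      unfolding lhs using ij assms by (subst bordered_mat_index) (auto simp: wheel_simps)
  next
    case False
    have arc: "(i + 1, j + 1) \<in> parcs (wheel n) \<longleftrightarrow>
        j = i + 1 \<or> i = j + 1 \<or> i = n - 1 \<and> j = 1 \<or> i = 1 \<and> j = n - 1"
      using False ij assms by (auto simp: wheel_simps)
    have md: "(j - 1 + (n - 1) - (i - 1)) mod (n - 1) = (if i \<le> j then j - i else j + (n - 1) - i)"
    proof (cases "i \<le> j")
      case True
      then have "j - 1 + (n - 1) - (i - 1) = (j - i) + (n - 1)"
        using False by simp
      moreover have "(j - i) mod (n - 1) = j - i"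
        using False ij by (intro mod_less) auto
      ultimately show ?thesis
        using True by (simp only: mod_add_self2 if_True)
    next
      case F: False
      then have "j - 1 + (n - 1) - (i - 1) = j + (n - 1) - i"
        using False by simp
      moreover have "(j + (n - 1) - i) mod (n - 1) = j + (n - 1) - i"
        using F False ij by (intro mod_less) auto
      ultimately show ?thesis
        using F by (simp only: if_False)
    qed
    have "bordered_mat 0 1 (circ ?u) $$ (i, j) = circ ?u $$ (i - 1, j - 1)"
      using False ij by (subst bordered_mat_index) auto
    also have "\<dots> = ?u $ ((j - 1 + (n - 1) - (i - 1)) mod (n - 1))"
      using False ij by (subst circ_index) auto
    also have "\<dots> = (if i = j then 0 else if (i + 1, j + 1) \<in> parcs (wheel n) then 1 else 2)"
      unfolding md arc
    proof (cases "i \<le> j")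
      case True
      have k: "j - i < n - 1" and "j - i = 0 \<longleftrightarrow> i = j" "j - i = 1 \<longleftrightarrow> j = i + 1"
        "j - i = n - 2 \<longleftrightarrow> i = 1 \<and> j = n - 1" "i \<noteq> j + 1" "\<not> (i = n - 1 \<and> j = 1)"
        using True False ij assms by linarith+
      then show "?u $ (if i \<le> j then j - i else j + (n - 1) - i) =
        (if i = j then 0 else if j = i + 1 \<or> i = j + 1 \<or> i = n - 1 \<and> j = 1 \<or> i = 1 \<and> j = n - 1 then 1 else 2)"
        by (simp only: True if_True index_vec[OF k] simp_thms)
    next
      case F: False
      let ?k = "j + (n - 1) - i"
      have k: "?k < n - 1" and "?k \<noteq> 0" "?k = 1 \<longleftrightarrow> i = n - 1 \<and> j = 1"
        "?k = n - 2 \<longleftrightarrow> i = j + 1" "i \<noteq> j" "j \<noteq> i + 1" "\<not> (i = 1 \<and> j = n - 1)"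
        using F False ij assms by linarith+
      then show "?u $ (if i \<le> j then j - i else ?k) =
        (if i = j then 0 else if j = i + 1 \<or> i = j + 1 \<or> i = n - 1 \<and> j = 1 \<or> i = 1 \<and> j = n - 1 then 1 else 2)"
        using F by (simp only: if_False index_vec[OF k] simp_thms disj_commute)
    qed
    finally show ?thesis
      unfolding lhs by simp
  qed
qed (use assms in \<open>auto simp: distance_matrix_def\<close>)

definition moore_penrose :: "real mat \<Rightarrow> real mat \<Rightarrow> bool" where
  "moore_penrose A X \<longleftrightarrow>
     X \<in> carrier_mat (dim_col A) (dim_row A) \<and>
     A * X * A = A \<and> X * A * X = X \<and>
     transpose_mat (A * X) = A * X \<and> transpose_mat (X * A) = X * A"

definition pinv :: "real mat \<Rightarrow> real mat" where
  "pinv A = (THE X. moore_penrose A X)"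

lemma moore_penrose_unique:
  assumes X: "moore_penrose A X" and Y: "moore_penrose A Y"
  shows "X = Y"
proof -
  let ?m = "dim_row A" and ?n = "dim_col A"
  have A: "A \<in> carrier_mat ?m ?n"
    by simp
  have cX: "X \<in> carrier_mat ?n ?m" and cY: "Y \<in> carrier_mat ?n ?m"
    using X Y by (auto simp: moore_penrose_def)
  have AX: "A * X \<in> carrier_mat ?m ?m" and AY: "A * Y \<in> carrier_mat ?m ?m"
    and XA: "X * A \<in> carrier_mat ?n ?n" and YA: "Y * A \<in> carrier_mat ?n ?n"
    using A cX cY by auto
  have "A * X = A * Y * A * X"
    using Y by (simp add: moore_penrose_def)
  also have "\<dots> = (A * Y) * (A * X)"
    using assoc_mult_mat[OF AY A cX] .
  finally have 1: "A * X = (A * Y) * (A * X)" .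
  have "A * X = transpose_mat ((A * Y) * (A * X))"
    using X 1 by (simp add: moore_penrose_def)
  also have "\<dots> = transpose_mat (A * X) * transpose_mat (A * Y)"
    by (rule transpose_mult[OF AY AX])
  also have "\<dots> = (A * X) * (A * Y)"
    using X Y by (simp add: moore_penrose_def)
  also have "\<dots> = A * X * A * Y"
    using assoc_mult_mat[OF AX A cY] by simp
  also have "\<dots> = A * Y"
    using X by (simp add: moore_penrose_def)
  finally have AXY: "A * X = A * Y" .
  have "X * A = X * (A * Y * A)"
    using Y by (simp add: moore_penrose_def)
  also have "\<dots> = X * (A * (Y * A))"
    using assoc_mult_mat[OF A cY A] by simp
  also have "\<dots> = (X * A) * (Y * A)"
    using assoc_mult_mat[OF cX A YA] by simp
  finally have 2: "X * A = (X * A) * (Y * A)" .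
  have "X * A = transpose_mat ((X * A) * (Y * A))"
    using X 2 by (simp add: moore_penrose_def)
  also have "\<dots> = transpose_mat (Y * A) * transpose_mat (X * A)"
    by (rule transpose_mult[OF XA YA])
  also have "\<dots> = (Y * A) * (X * A)"
    using X Y by (simp add: moore_penrose_def)
  also have "\<dots> = Y * (A * (X * A))"
    using assoc_mult_mat[OF cY A XA] .
  also have "A * (X * A) = A"
    using X assoc_mult_mat[OF A cX A] by (simp add: moore_penrose_def)
  finally have XYA: "X * A = Y * A" .
  have "X = X * A * X"
    using X by (simp add: moore_penrose_def)
  also have "\<dots> = Y * A * X"
    by (simp only: XYA)
  also have "\<dots> = Y * (A * X)"
    using assoc_mult_mat[OF cY A cX] .
  also have "\<dots> = Y * (A * Y)"
    by (simp only: AXY)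
  also have "\<dots> = Y * A * Y"
    using assoc_mult_mat[OF cY A cY] by simp
  also have "\<dots> = Y"
    using Y by (simp add: moore_penrose_def)
  finally show ?thesis .
qed

lemma pinv_eqI: "moore_penrose A X \<Longrightarrow> pinv A = X"
  unfolding pinv_def by (blast intro: the_equality moore_penrose_unique)

definition a_vec :: "nat \<Rightarrow> real vec" where
  "a_vec n = vec n (\<lambda>i. if i = 0 then 0 else if odd i then - 1 else 1)"

definition v_vec :: "nat \<Rightarrow> real vec" where
  "v_vec n = vec (n - 1) (\<lambda>i. if even i then 1 else - 1)"

definition z_even :: "nat \<Rightarrow> nat \<Rightarrow> real" where
  "z_even n k =
     (- 6 * (real n - 1) * real k ^ 2 + 6 * (real n - 1) ^ 2 * real k
      - real n ^ 3 + 3 * real n ^ 2 + real n + 9) / 12"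

definition z_odd :: "nat \<Rightarrow> nat \<Rightarrow> real" where
  "z_odd n k =
     (6 * (real n - 1) * real k ^ 2 - 6 * (real n - 1) ^ 2 * real k
      + real n ^ 3 - 3 * real n ^ 2 + 5 * real n - 15) / 12"

text \<open>The last clause covers the indices \<open>k\<close> and \<open>n - 1 - k\<close> for \<open>1 \<le> k \<le> (n - 3) / 2\<close>,
  with \<open>l\<close> the smaller of the two.\<close>

definition z_vec :: "nat \<Rightarrow> real vec" where
  "z_vec n = vec (n - 1) (\<lambda>k.
     if k = 0 then (- (real n ^ 3) + 3 * real n ^ 2 + real n + 9) / 12
     else if k = (n - 1) div 2 then
       (if n mod 4 = 1
        then (real n ^ 3 - 3 * real n ^ 2 + 11 * real n + 15) / 24
        else (- (real n ^ 3) + 3 * real n ^ 2 + real n - 27) / 24)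
     else (let l = min k (n - 1 - k) in if even l then z_even n l else z_odd n l))"

end

theory Submission
  imports Defs "Jordan_Normal_Form.Determinant"
begin

text \<open>The matrix \<open>P = a a\<^sup>t\<close> satisfies \<open>D P = P D = 0\<close> and \<open>P\<^sup>2 = (n - 1) P\<close>, so the Moore--Penrose
  inverse of \<open>D\<close> is \<open>(D + P)\<inverse> - P / (n - 1)\<^sup>2\<close>. The inverse of \<open>D + P\<close> is verified by a cyclic
  convolution: with \<open>N = n - 1\<close> the sequence \<open>z\<close> is \<open>z(k) = (-1)\<^sup>k p(k) + N / 4\<close> for one quadratic
  polynomial \<open>p\<close> with leading coefficient \<open>- N / 2\<close> and \<open>p(0) = p(N)\<close>, and the first row of the
  circulant block of \<open>D\<close> acts on sequences with sum zero as \<open>k \<mapsto> - z(k - 1) - 2 z(k) - z(k + 1)\<close>,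
  which is a second difference of \<open>p\<close> up to sign.\<close>

subsection \<open>Cyclic convolution\<close>

text \<open>Adding \<open>dim_vec c\<close> before subtracting keeps the natural-number subtraction
  from truncating; \<open>circ_index\<close> uses the same index expression.\<close>

definition cconv :: "'a::comm_ring_1 vec \<Rightarrow> 'a vec \<Rightarrow> 'a vec" where
  "cconv c d = vec (dim_vec c)
     (\<lambda>l. \<Sum>m<dim_vec c. c $ m * d $ ((l + dim_vec c - m) mod dim_vec c))"

lemma dim_cconv [simp]: "dim_vec (cconv c d) = dim_vec c"
  by (simp add: cconv_def)

lemma mod_sub_eq:
  fixes i j N :: nat
  assumes "i < N" "j < N"
  shows "(j + N - i) mod N = (if i \<le> j then j - i else j + N - i)"
proof (cases "i \<le> j")
  case True
  then have "(j + N - i) mod N = ((j - i) + N) mod N" by simp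
  also have "\<dots> = j - i" using assms by (simp add: less_imp_diff_less)
  finally show ?thesis using True by simp
next
  case False
  with assms have "(j + N - i) mod N = j + N - i" by (intro mod_less) linarith
  with False show ?thesis by simp
qed

text \<open>A residue becomes a choice between two linear equations, so identities between residues
  can be left to linear arithmetic.\<close>

lemma mod_sub_add_cases:
  fixes i j N :: nat
  assumes "i < N" "j < N"
  shows "(j + N - i) mod N + i = j \<or> (j + N - i) mod N + i = j + N"
  using assms by (simp add: mod_sub_eq)

lemma mod_sub_sub:
  fixes i j k N :: nat
  assumes "i < N" "j < N" "k < N"
  shows "((j + N - i) mod N + N - (k + N - i) mod N) mod N = (j + N - k) mod N"
proof -
  have bounds: "(j + N - i) mod N < N" "(k + N - i) mod N < N" "(j + N - k) mod N < N"
    "((j + N - i) mod N + N - (k + N - i) mod N) mod N < N"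
    using assms by auto
  \<comment> \<open>In every case the two sides differ by a multiple of \<open>N\<close>, and the
    bounds force that multiple to be zero.\<close>
  show ?thesis
    using mod_sub_add_cases[OF assms(1,2)] mod_sub_add_cases[OF assms(1,3)]
      mod_sub_add_cases[OF assms(3,2)] mod_sub_add_cases[OF bounds(2,1)] bounds
    by (elim disjE) linarith+
qed

lemma sum_mod_shift:
  fixes i N :: nat
  assumes "i < N"
  shows "(\<Sum>k<N. f ((k + N - i) mod N)) = sum f {..<N}"
proof (rule sum.reindex_bij_witness[where i = "\<lambda>m. if m + i < N then m + i else m + i - N"
      and j = "\<lambda>k. (k + N - i) mod N"])
qed (use assms in \<open>auto simp: mod_sub_eq split: if_splits\<close>)

text \<open>The map sending k to l - k is an involution on residues, so it serves as both
  witnesses.\<close>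

lemma sum_mod_reflect:
  fixes l N :: nat
  assumes "l < N"
  shows "(\<Sum>k<N. f ((l + N - k) mod N)) = sum f {..<N}"
proof (rule sum.reindex_bij_witness[where i = "\<lambda>k. (l + N - k) mod N"
      and j = "\<lambda>k. (l + N - k) mod N"])
qed (use assms in \<open>auto simp: mod_sub_eq split: if_splits\<close>)

lemma cconv_commute:
  assumes "dim_vec c = dim_vec d"
  shows "cconv c d = cconv d c"
proof (rule eq_vecI)
  fix l assume "l < dim_vec (cconv d c)"
  then have l: "l < dim_vec d" by simp
  let ?N = "dim_vec d"
  have "(\<Sum>m<?N. c $ m * d $ ((l + ?N - m) mod ?N)) =
    (\<Sum>m<?N. c $ ((l + ?N - m) mod ?N) * d $ ((l + ?N - (l + ?N - m) mod ?N) mod ?N))"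
    by (rule sum_mod_reflect[OF l, symmetric])
  also have "\<dots> = (\<Sum>m<?N. d $ m * c $ ((l + ?N - m) mod ?N))"
    by (intro sum.cong refl) (use l in \<open>auto simp: mod_sub_eq\<close>)
  finally show "cconv c d $ l = cconv d c $ l"
    using l assms by (simp add: cconv_def)
qed (use assms in simp)

section \<open>Algebra of circulant and bordered circulant matrices\<close>

lemma circ_mult:
  fixes c d :: "'a::comm_ring_1 vec"
  assumes "dim_vec c = N" "dim_vec d = N"
  shows "circ c * circ d = circ (cconv c d)"
proof (rule eq_matI)
  fix i j assume "i < dim_row (circ (cconv c d))" "j < dim_col (circ (cconv c d))"
  then have ij: "i < N" "j < N" using assms by auto
  then have l: "(j + N - i) mod N < N" by simp
  have "(circ c * circ d) $$ (i, j) = (\<Sum>k<N. c $ ((k + N - i) mod N) * d $ ((j + N - k) mod N))"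
    using ij assms
    by (auto simp: scalar_prod_def circ_index atLeast0LessThan intro!: sum.cong)
  \<comment> \<open>Writing j - k as (j - i) - (k - i) leaves k only inside k - i, so
    \<open>sum_mod_shift\<close> yields the convolution at j - i.\<close>
  also have "\<dots> = (\<Sum>k<N. c $ ((k + N - i) mod N) *
      d $ (((j + N - i) mod N + N - (k + N - i) mod N) mod N))"
    using ij by (intro sum.cong refl) (simp add: mod_sub_sub)
  also have "\<dots> = (\<Sum>m<N. c $ m * d $ (((j + N - i) mod N + N - m) mod N))"
    by (rule sum_mod_shift[OF ij(1)])
  finally show "(circ c * circ d) $$ (i, j) = circ (cconv c d) $$ (i, j)"
    using ij assms l by (simp add: circ_index cconv_def)
qed (use assms in auto)

lemma circ_row_sum:
  assumes "dim_vec c = N" "i < N"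
  shows "(\<Sum>j<N. circ c $$ (i, j)) = (\<Sum>k<N. c $ k)"
  using sum_mod_shift[OF assms(2), of "\<lambda>k. c $ k"] assms by (simp add: circ_index)

lemma circ_col_sum:
  assumes "dim_vec c = N" "j < N"
  shows "(\<Sum>i<N. circ c $$ (i, j)) = (\<Sum>k<N. c $ k)"
  using sum_mod_reflect[OF assms(2), of "\<lambda>k. c $ k"] assms by (simp add: circ_index)

text \<open>Circulants have constant row and column sums, so each side of the product's border is
  constant; \<open>row\<close> and \<open>col\<close> make the two sides agree. The summand
  \<open>\<beta> * \<delta>\<close> in \<open>conv\<close> is what the two borders contribute to the
  inner block.\<close>

lemma bordered_mat_circ_mult:
  assumes d: "dim_vec c = N" "dim_vec d = N" "dim_vec e = N"
    and corner: "\<alpha> * \<gamma> + real N * \<beta> * \<delta> = \<epsilon>"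
    and row: "\<alpha> * \<delta> + \<beta> * (\<Sum>k<N. d $ k) = \<zeta>"
    and col: "\<beta> * \<gamma> + \<delta> * (\<Sum>k<N. c $ k) = \<zeta>"
    and conv: "\<And>l. l < N \<Longrightarrow> \<beta> * \<delta> + cconv c d $ l = e $ l"
  shows "bordered_mat \<alpha> \<beta> (circ c) * bordered_mat \<gamma> \<delta> (circ d) = bordered_mat \<epsilon> \<zeta> (circ e)"
proof (rule eq_matI)
  fix i j
  assume "i < dim_row (bordered_mat \<epsilon> \<zeta> (circ e))" "j < dim_col (bordered_mat \<epsilon> \<zeta> (circ e))"
  then have ij: "i \<le> N" "j \<le> N" using d by auto
  let ?A = "bordered_mat \<alpha> \<beta> (circ c)" and ?B = "bordered_mat \<gamma> \<delta> (circ d)"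
  have "(?A * ?B) $$ (i, j) = (\<Sum>k<Suc N. ?A $$ (i, k) * ?B $$ (k, j))"
    using ij d by (auto simp: scalar_prod_def atLeast0LessThan less_Suc_eq_le simp del: sum.lessThan_Suc)
  also have "\<dots> = ?A $$ (i, 0) * ?B $$ (0, j) + (\<Sum>k<N. ?A $$ (i, Suc k) * ?B $$ (Suc k, j))"
    by (simp add: sum.lessThan_Suc_shift del: sum.lessThan_Suc)
  also have "\<dots> = bordered_mat \<epsilon> \<zeta> (circ e) $$ (i, j)"
  proof -
    consider "i = 0" "j = 0" | j' where "i = 0" "j = Suc j'" "j' < N"
      | i' where "i = Suc i'" "i' < N" "j = 0"
      | i' j' where "i = Suc i'" "i' < N" "j = Suc j'" "j' < N"
      using ij by (cases i; cases j) auto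
    then show ?thesis
    proof cases
      case 1
      then show ?thesis using d corner by (simp add: bordered_mat_index)
    next
      case 2
      then have "(\<Sum>k<N. ?A $$ (i, Suc k) * ?B $$ (Suc k, j)) = \<beta> * (\<Sum>k<N. circ d $$ (k, j'))"
        using d by (simp add: bordered_mat_index sum_distrib_left)
      then show ?thesis
        using 2 d row by (simp add: bordered_mat_index circ_col_sum)
    next
      case 3
      then have "(\<Sum>k<N. ?A $$ (i, Suc k) * ?B $$ (Suc k, j)) = \<delta> * (\<Sum>k<N. circ c $$ (i', k))"
        using d by (simp add: bordered_mat_index sum_distrib_left mult.commute)
      then show ?thesis
        using 3 d col by (simp add: bordered_mat_index circ_row_sum)
    next
      case 4
      then have "(\<Sum>k<N. ?A $$ (i, Suc k) * ?B $$ (Suc k, j)) =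
          (\<Sum>k<N. circ c $$ (i', k) * circ d $$ (k, j'))"
        using d by (simp add: bordered_mat_index)
      also have "\<dots> = (circ c * circ d) $$ (i', j')"
        using 4 d by (simp add: scalar_prod_def atLeast0LessThan)
      also have "\<dots> = cconv c d $ ((j' + N - i') mod N)"
        using 4 d by (simp add: circ_mult[OF d(1,2)] circ_index)
      finally show ?thesis
        using 4 d conv[of "(j' + N - i') mod N"] by (simp add: bordered_mat_index circ_index)
    qed
  qed
  finally show "(?A * ?B) $$ (i, j) = bordered_mat \<epsilon> \<zeta> (circ e) $$ (i, j)" .
qed (use d in auto)

lemma bordered_mat_circ_add:
  assumes "dim_vec c = dim_vec d"
  shows "bordered_mat \<alpha> \<beta> (circ c) + bordered_mat \<gamma> \<delta> (circ d) =
    bordered_mat (\<alpha> + \<gamma>) (\<beta> + \<delta>) (circ (c + d))"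
  by (rule eq_matI) (use assms in \<open>auto simp: bordered_mat_index circ_index less_Suc_eq_le\<close>)

lemma bordered_mat_circ_diff:
  assumes "dim_vec c = dim_vec d"
  shows "bordered_mat \<alpha> \<beta> (circ c) - bordered_mat \<gamma> \<delta> (circ d) =
    bordered_mat (\<alpha> - \<gamma>) (\<beta> - \<delta>) (circ (c - d))"
  by (rule eq_matI) (use assms in \<open>auto simp: bordered_mat_index circ_index less_Suc_eq_le\<close>)

lemma bordered_mat_circ_smult:
  "x \<cdot>\<^sub>m bordered_mat \<alpha> \<beta> (circ c) = bordered_mat (x * \<alpha>) (x * \<beta>) (circ (x \<cdot>\<^sub>v c))"
  by (rule eq_matI) (auto simp: bordered_mat_index circ_index less_Suc_eq_le)

lemma bordered_mat_circ_zero: "bordered_mat 0 0 (circ (0\<^sub>v N)) = 0\<^sub>m (Suc N) (Suc N)"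
  by (rule eq_matI) (auto simp: bordered_mat_index circ_index less_Suc_eq_le)

text \<open>Brings scalar matrices into the form of the right-hand side of
  \<open>bordered_mat_circ_mult\<close>.\<close>

lemma bordered_mat_circ_one:
  "bordered_mat x 0 (circ (vec N (\<lambda>l. if l = 0 then x else 0))) = x \<cdot>\<^sub>m 1\<^sub>m (Suc N)"
proof (rule eq_matI)
  fix i j assume "i < dim_row (x \<cdot>\<^sub>m 1\<^sub>m (Suc N))" "j < dim_col (x \<cdot>\<^sub>m 1\<^sub>m (Suc N))"
  then have ij: "i \<le> N" "j \<le> N" by auto
  let ?d = "vec N (\<lambda>l. if l = 0 then x else 0) :: real vec"
  show "bordered_mat x 0 (circ ?d) $$ (i, j) = (x \<cdot>\<^sub>m 1\<^sub>m (Suc N)) $$ (i, j)"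
  proof (cases "i = 0 \<or> j = 0")
    case True
    then show ?thesis using ij by (auto simp: bordered_mat_index)
  next
    case False
    then obtain i' j' where "i = Suc i'" "j = Suc j'" by (cases i; cases j) auto
    moreover from this have "(j' + N - i') mod N = 0 \<longleftrightarrow> i' = j'"
      using ij by (subst mod_sub_eq) auto
    ultimately show ?thesis
      using ij by (simp add: bordered_mat_index circ_index)
  qed
qed auto

subsection \<open>Pseudoinverse of a singular matrix from an invertible completion\<close>

text \<open>\<open>P\<close> / \<open>c\<close> is an orthogonal projection annihilated by
  \<open>A\<close> from both sides. \<open>B\<close> acts on its range as 1 / \<open>c\<close>, so
  subtracting \<open>P\<close> / c^2 removes that part of \<open>B\<close>. Both products of
  \<open>A\<close> with the result are the complementary projection, hence symmetric.\<close>

lemma pinv_eq_of_complement: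
  fixes A B P :: "real mat"
  assumes carr: "A \<in> carrier_mat n n" "P \<in> carrier_mat n n" "B \<in> carrier_mat n n"
    and AP: "A * P = 0\<^sub>m n n" and PA: "P * A = 0\<^sub>m n n" and PP: "P * P = c \<cdot>\<^sub>m P"
    and c: "c \<noteq> 0" and sym: "transpose_mat P = P"
    and MB: "(A + P) * B = 1\<^sub>m n" and BM: "B * (A + P) = 1\<^sub>m n"
  shows "pinv A = B - (1 / c\<^sup>2) \<cdot>\<^sub>m P"
proof (rule pinv_eqI)
  let ?X = "B - (1 / c\<^sup>2) \<cdot>\<^sub>m P"
  let ?E = "1\<^sub>m n - (1 / c) \<cdot>\<^sub>m P"
  have X: "?X \<in> carrier_mat n n" and E: "?E \<in> carrier_mat n n"
    and AP': "A + P \<in> carrier_mat n n"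
    using carr by auto
  have smult: "(1 / c) \<cdot>\<^sub>m (c \<cdot>\<^sub>m Y) = Y" for Y :: "real mat"
    using c by (intro eq_matI) auto
  have "(A + P) * P = c \<cdot>\<^sub>m P"
    using add_mult_distrib_mat[OF carr(1,2,2)] carr AP PP by simp
  then have "B * (c \<cdot>\<^sub>m P) = P"
    using assoc_mult_mat[OF carr(3) AP' carr(2)] BM carr by simp
  then have "c \<cdot>\<^sub>m (B * P) = P"
    using mult_smult_distrib[OF carr(3,2)] by simp
  then have BP: "B * P = (1 / c) \<cdot>\<^sub>m P"
    using smult[of "B * P"] by simp
  have "P * (A + P) = c \<cdot>\<^sub>m P"
    using mult_add_distrib_mat[OF carr(2,1,2)] carr PA PP by simp
  then have "(c \<cdot>\<^sub>m P) * B = P"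
    using assoc_mult_mat[OF carr(2) AP' carr(3)] MB carr by simp
  then have "c \<cdot>\<^sub>m (P * B) = P"
    using mult_smult_assoc_mat[OF carr(2,3)] by simp
  then have PB: "P * B = (1 / c) \<cdot>\<^sub>m P"
    using smult[of "P * B"] by simp
  have cancel: "Y = Z - W" if "Y + W = Z" "Y \<in> carrier_mat n n" "W \<in> carrier_mat n n"
    for Y Z W :: "real mat"
    using that by (intro eq_matI) auto
  have minus_zero: "Y - 0\<^sub>m n n = Y" if "Y \<in> carrier_mat n n" for Y :: "real mat"
    using that by (intro eq_matI) auto
  have AB: "A * B = ?E"
    using add_mult_distrib_mat[OF carr] MB PB carr by (intro cancel) auto
  have BA: "B * A = ?E"
    using mult_add_distrib_mat[OF carr(3,1,2)] BM BP carr by (intro cancel) auto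
  have AX: "A * ?X = ?E"
  proof -
    have "A * ?X = A * B - A * ((1 / c\<^sup>2) \<cdot>\<^sub>m P)"
      using carr by (intro mult_minus_distrib_mat) auto
    also have "A * ((1 / c\<^sup>2) \<cdot>\<^sub>m P) = 0\<^sub>m n n"
      using mult_smult_distrib[OF carr(1,2)] AP by simp
    finally show ?thesis using AB minus_zero[OF E] by simp
  qed
  have XA: "?X * A = ?E"
  proof -
    have "?X * A = B * A - ((1 / c\<^sup>2) \<cdot>\<^sub>m P) * A"
      using carr by (intro minus_mult_distrib_mat) auto
    also have "((1 / c\<^sup>2) \<cdot>\<^sub>m P) * A = 0\<^sub>m n n"
      using mult_smult_assoc_mat[OF carr(2,1)] PA by simp
    finally show ?thesis using BA minus_zero[OF E] by simp
  qed
  have EA: "?E * A = A"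
  proof -
    have "?E * A = 1\<^sub>m n * A - ((1 / c) \<cdot>\<^sub>m P) * A"
      using carr by (intro minus_mult_distrib_mat) auto
    also have "((1 / c) \<cdot>\<^sub>m P) * A = 0\<^sub>m n n"
      using mult_smult_assoc_mat[OF carr(2,1)] PA by simp
    finally show ?thesis using carr minus_zero[OF carr(1)] by simp
  qed
  \<comment> \<open>This fixes the coefficient 1 / c^2: the products with \<open>A\<close> would be
    the same for any multiple of \<open>P\<close>.\<close>
  have PX: "P * ?X = 0\<^sub>m n n"
  proof -
    have "P * ?X = P * B - P * ((1 / c\<^sup>2) \<cdot>\<^sub>m P)"
      using carr by (intro mult_minus_distrib_mat) auto
    also have "P * ((1 / c\<^sup>2) \<cdot>\<^sub>m P) = (1 / c\<^sup>2) \<cdot>\<^sub>m (c \<cdot>\<^sub>m P)"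
      using mult_smult_distrib[OF carr(2,2)] PP by simp
    also have "\<dots> = (1 / c) \<cdot>\<^sub>m P"
      using c by (intro eq_matI) (auto simp: power2_eq_square)
    finally show ?thesis using PB carr by auto
  qed
  have EX: "?E * ?X = ?X"
  proof -
    have "?E * ?X = 1\<^sub>m n * ?X - ((1 / c) \<cdot>\<^sub>m P) * ?X"
      using carr(2) by (intro minus_mult_distrib_mat[OF one_carrier_mat _ X]) auto
    also have "((1 / c) \<cdot>\<^sub>m P) * ?X = 0\<^sub>m n n"
      unfolding mult_smult_assoc_mat[OF carr(2) X] PX by simp
    also have "1\<^sub>m n * ?X - 0\<^sub>m n n = ?X"
      unfolding left_mult_one_mat[OF X] by (rule minus_zero[OF X])
    finally show ?thesis .
  qed
  have "transpose_mat ?E = 1\<^sub>m n - (1 / c) \<cdot>\<^sub>m transpose_mat P"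
    using carr by (intro eq_matI) auto
  then have "transpose_mat ?E = ?E"
    using sym by simp
  then show "moore_penrose A ?X"
    unfolding moore_penrose_def using AX XA EA EX X carr by simp
qed

subsection \<open>The wheel graph with an odd number of vertices\<close>

definition u_vec :: "nat \<Rightarrow> real vec" where
  "u_vec N = vec N (\<lambda>i. if i = 0 then 0 else if i = 1 \<or> i = N - 1 then 1 else 2)"

text \<open>\<open>u_vec N\<close> is the constant 2 lowered by 2 at index 0 and by 1 at the indices
  1 and N - 1, which are distinct for \<open>4 \<le> N\<close>.\<close>

lemma cconv_u_vec:
  assumes N: "4 \<le> N" and d: "dim_vec d = N" and l: "l < N"
  shows "cconv (u_vec N) d $ l = 2 * (\<Sum>k<N. d $ k) - 2 * d $ l
    - d $ (if l = 0 then N - 1 else l - 1) - d $ (if Suc l = N then 0 else Suc l)"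
proof -
  let ?r = "\<lambda>m. (l + N - m) mod N"
  have r: "?r 0 = l" "?r 1 = (if l = 0 then N - 1 else l - 1)"
    "?r (N - 1) = (if Suc l = N then 0 else Suc l)"
    using l N by (auto simp: mod_sub_eq)
  have "cconv (u_vec N) d $ l = (\<Sum>m<N. u_vec N $ m * d $ ?r m)"
    using l d by (simp add: cconv_def u_vec_def)
  also have "\<dots> = (\<Sum>m<N. 2 * d $ ?r m - (if m = 0 then 2 * d $ ?r 0 else 0)
      - (if m = 1 then d $ ?r 1 else 0) - (if m = N - 1 then d $ ?r (N - 1) else 0))"
    using N by (intro sum.cong) (auto simp: u_vec_def)
  also have "\<dots> = 2 * (\<Sum>m<N. d $ ?r m) - 2 * d $ ?r 0 - d $ ?r 1 - d $ ?r (N - 1)"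
    using N by (simp add: sum_subtractf sum_distrib_left)
  also have "(\<Sum>m<N. d $ ?r m) = (\<Sum>k<N. d $ k)"
    by (rule sum_mod_reflect[OF l])
  finally show ?thesis
    unfolding r .
qed

lemma minus_one_power_mod_sub:
  fixes l m N :: nat
  assumes "even N" "l < N" "m < N"
  shows "(- 1 :: real) ^ ((l + N - m) mod N) = (- 1) ^ l * (- 1) ^ m"
proof -
  have "even ((l + N - m) mod N) \<longleftrightarrow> even (l + m)"
    using assms by (auto simp: mod_sub_eq)
  then show ?thesis
    by (metis minus_one_power_iff power_add)
qed

text \<open>For even \<open>N\<close> the alternating sequence is a character of the integers modulo
  \<open>N\<close>, so convolution with \<open>d\<close> only scales it, by a Fourier coefficient of
  \<open>d\<close>.\<close>

lemma cconv_alternating: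
  assumes N: "even N" and d: "dim_vec d = N" and l: "l < N"
  shows "cconv (vec N (\<lambda>i. (- 1 :: real) ^ i)) d $ l = (- 1) ^ l * (\<Sum>k<N. (- 1) ^ k * d $ k)"
proof -
  let ?r = "\<lambda>m. (l + N - m) mod N"
  have "cconv (vec N (\<lambda>i. (- 1) ^ i)) d $ l = (\<Sum>m<N. (- 1) ^ m * d $ ?r m)"
    using l d by (simp add: cconv_def)
  also have "\<dots> = (\<Sum>m<N. (- 1) ^ l * ((- 1) ^ ?r m * d $ ?r m))"
    using N l by (intro sum.cong refl) (simp add: minus_one_power_mod_sub)
  also have "\<dots> = (- 1) ^ l * (\<Sum>m<N. (- 1) ^ ?r m * d $ ?r m)"
    by (simp add: sum_distrib_left)
  also have "(\<Sum>m<N. (- 1) ^ ?r m * d $ ?r m) = (\<Sum>k<N. (- 1) ^ k * d $ k)"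
    by (rule sum_mod_reflect[OF l])
  finally show ?thesis .
qed

lemma v_vec_alt: "v_vec n = vec (n - 1) (\<lambda>i. (- 1) ^ i)"
  by (auto simp: v_vec_def)

section \<open>The sequence z as an alternating quadratic\<close>

definition z_poly :: "real \<Rightarrow> real \<Rightarrow> real" where
  "z_poly N k = (- 6 * N * k\<^sup>2 + 6 * N\<^sup>2 * k - N ^ 3 + N + 12) / 12"

text \<open>The even and odd formulas add up to the constant N / 2; splitting off half of it from
  each leaves opposite quadratics.\<close>

lemma z_even_alt: "z_even (Suc N) k = z_poly N k + real N / 4"
  by (simp add: z_even_def z_poly_def field_simps power2_eq_square power3_eq_cube)

lemma z_odd_alt: "z_odd (Suc N) k = - z_poly N k + real N / 4"
  by (simp add: z_odd_def z_poly_def field_simps power2_eq_square power3_eq_cube)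

lemma z_poly_reflect: "z_poly N (N - k) = z_poly N k"
  by (simp add: z_poly_def algebra_simps power2_eq_square)

lemma dim_z_vec [simp]: "dim_vec (z_vec n) = n - 1"
  by (simp add: z_vec_def)

text \<open>For even \<open>N\<close> the reflection of k to N - k preserves both the sign and
  \<open>z_poly N\<close>, so passing to the smaller index changes nothing.\<close>

lemma z_vec_index:
  assumes N: "even N" "0 < N" and k: "k < N"
  shows "z_vec (Suc N) $ k = (- 1) ^ k * z_poly N k + real N / 4"
proof -
  have zl: "(if even l then z_even (Suc N) l else z_odd (Suc N) l) =
      (- 1) ^ l * z_poly N l + real N / 4" for l
    by (simp add: z_even_alt z_odd_alt)
  obtain h where h: "N = 2 * h" using N by (auto elim: evenE)
  consider "k = 0" | "k = h" "k \<noteq> 0" | "k \<noteq> 0" "k \<noteq> h" by blast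
  then show ?thesis
  proof cases
    case 1
    then show ?thesis
      using k by (simp add: z_vec_def z_poly_def field_simps power2_eq_square power3_eq_cube)
  next
    case 2
    \<comment> \<open>At the middle index the residue of n modulo 4 encodes the sign (-1)^h.\<close>
    have "Suc (2 * h) mod 4 = 1 \<longleftrightarrow> even h" by presburger
    then show ?thesis
      using 2 k h
      by (simp add: z_vec_def z_poly_def field_simps power2_eq_square power3_eq_cube)
  next
    case 3
    let ?l = "min k (N - k)"
    have "z_vec (Suc N) $ k = (- 1) ^ ?l * z_poly N ?l + real N / 4"
      unfolding zl[symmetric] using 3 k h by (simp add: z_vec_def Let_def)
    also have "(- 1 :: real) ^ ?l = (- 1) ^ k"
      using N k by (auto simp: min_def minus_one_power_iff)
    also have "z_poly N ?l = z_poly N k"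
      using k z_poly_reflect[of N k] by (auto simp: min_def of_nat_diff)
    finally show ?thesis .
  qed
qed

lemma sum_z_poly:
  "(\<Sum>k<m. z_poly N (real k)) = (- N * (real m - 1) * real m * (2 * real m - 1)
     + 3 * N\<^sup>2 * real m * (real m - 1) + (- (N ^ 3) + N + 12) * real m) / 12"
  by (induction m) (simp_all add: z_poly_def field_simps power2_eq_square power3_eq_cube)

text \<open>\<open>N\<close> stays independent of \<open>h\<close> for the induction. At N = 2 h the
  value is -N^2 / 4, which the offsets N / 4 compensate in \<open>sum_z_vec\<close>.\<close>

lemma sum_alternating_z_poly:
  "(\<Sum>k<2 * h. (- 1) ^ k * z_poly N (real k)) = (N * real h * (2 * real h - 1) - N\<^sup>2 * real h) / 2"
  by (induction h) (simp_all add: z_poly_def field_simps power2_eq_square power3_eq_cube)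

lemma sum_minus_one_power_even: "even N \<Longrightarrow> (\<Sum>k<N. (- 1 :: real) ^ k) = 0"
  by (auto elim!: evenE simp: sum_gp_strict)

lemma sum_z_vec:
  assumes "even N" "0 < N"
  shows "(\<Sum>k<N. z_vec (Suc N) $ k) = 0"
proof -
  obtain h where h: "N = 2 * h" using assms by (auto elim: evenE)
  have "(\<Sum>k<N. z_vec (Suc N) $ k) = (\<Sum>k<N. (- 1) ^ k * z_poly N k) + real N * real N / 4"
    using assms by (simp add: z_vec_index sum.distrib)
  then show ?thesis
    unfolding h sum_alternating_z_poly by (simp add: field_simps power2_eq_square)
qed

text \<open>The signs cancel on the quadratic part, while the offset becomes alternating and drops
  out. The constant term of \<open>z_poly\<close> makes the remaining sum exactly N.\<close>

lemma sum_alternating_z_vec: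
  assumes "even N" "0 < N"
  shows "(\<Sum>k<N. (- 1) ^ k * z_vec (Suc N) $ k) = real N"
proof -
  have "(\<Sum>k<N. (- 1) ^ k * z_vec (Suc N) $ k) = (\<Sum>k<N. z_poly N k + (- 1) ^ k * (real N / 4))"
    using assms by (intro sum.cong refl)
      (simp add: z_vec_index distrib_left mult.assoc[symmetric] power_add[symmetric])
  also have "\<dots> = (\<Sum>k<N. z_poly N k)"
    using assms by (simp add: sum.distrib sum_minus_one_power_even flip: sum_divide_distrib sum_distrib_right)
  finally show ?thesis
    unfolding sum_z_poly by (simp add: field_simps power2_eq_square power3_eq_cube)
qed

text \<open>\<open>z_poly\<close> takes the same value at N and at 0, so the wrap-around at l = N -
  1 leaves no trace. Its value at -1 misses that at N - 1 by N^2, which creates the spike at l = 0.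
  The offsets N / 4, taken with total weight -4, give -N.\<close>

lemma cconv_u_vec_z_vec:
  assumes N: "even N" "4 \<le> N" and l: "l < N"
  shows "cconv (u_vec N) (z_vec (Suc N)) $ l =
    (if l = 0 then (real N)\<^sup>2 else 0) - real N - (- 1) ^ l * real N"
proof -
  have zi: "z_vec (Suc N) $ k = (- 1) ^ k * z_poly N k + real N / 4" if "k < N" for k
    using N that by (simp add: z_vec_index)
  have succ: "z_vec (Suc N) $ (if Suc l = N then 0 else Suc l) =
      - ((- 1) ^ l * z_poly N (real l + 1)) + real N / 4"
  proof (cases "Suc l = N")
    case True
    \<comment> \<open>Since \<open>l\<close> is odd, the sign -(-1)^l is the one that index 0
      carries.\<close>
    then have "odd l" using N by auto
    moreover have "z_poly N (real l + 1) = z_poly N 0"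
      using True z_poly_reflect[of N 0] by (simp add: add.commute flip: of_nat_Suc)
    ultimately show ?thesis using True N zi[of 0] by simp
  next
    case False
    then show ?thesis using l zi[of "Suc l"] by (simp add: add.commute)
  qed
  have prev: "z_vec (Suc N) $ (if l = 0 then N - 1 else l - 1) =
      - ((- 1) ^ l * z_poly N (real l - 1)) - (if l = 0 then (real N)\<^sup>2 else 0) + real N / 4"
  proof (cases "l = 0")
    case True
    have "odd (N - 1)" using N by simp
    then show ?thesis
      using True N zi[of "N - 1"] z_poly_reflect[of N 1]
      by (simp add: of_nat_diff) (simp add: z_poly_def field_simps power2_eq_square)
  next
    case False
    then obtain k where "l = Suc k" by (cases l) auto
    then show ?thesis using l zi[of k] by simp
  qed
  have "cconv (u_vec N) (z_vec (Suc N)) $ l = (if l = 0 then (real N)\<^sup>2 else 0) - real N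
      - (- 1) ^ l * (2 * z_poly N l - z_poly N (real l + 1) - z_poly N (real l - 1))"
    using N l sum_z_vec[of N] by (simp only: cconv_u_vec dim_z_vec diff_Suc_1 succ prev zi)
      (simp add: algebra_simps)
  also have "2 * z_poly N l - z_poly N (real l + 1) - z_poly N (real l - 1) = real N"
    by (simp add: z_poly_def field_simps power2_eq_square)
  finally show ?thesis .
qed

text \<open>The zero entry of a gives the zero border. Elsewhere the product of two entries depends
  only on the parity of j - i, which survives reduction modulo the even number n - 1.\<close>

lemma outer_a_vec:
  "col_mat (a_vec n) * transpose_mat (col_mat (a_vec n)) = bordered_mat 0 0 (circ (v_vec n))"
  if "odd n"
proof (rule eq_matI)
  fix i j
  assume "i < dim_row (bordered_mat 0 0 (circ (v_vec n)))" "j < dim_col (bordered_mat 0 0 (circ (v_vec n)))"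
  then have ij: "i < n" "j < n" using that by (auto simp: v_vec_def elim: oddE)
  have "(col_mat (a_vec n) * transpose_mat (col_mat (a_vec n))) $$ (i, j) = a_vec n $ i * a_vec n $ j"
    using ij by (simp add: col_mat_def mat_of_cols_index a_vec_def scalar_prod_def)
  also have "\<dots> = bordered_mat 0 0 (circ (v_vec n)) $$ (i, j)"
  proof (cases "i = 0 \<or> j = 0")
    case True
    then show ?thesis
      using ij by (auto simp: a_vec_def bordered_mat_index v_vec_def)
  next
    case False
    then obtain i' j' where i'j': "i = Suc i'" "j = Suc j'" by (cases i; cases j) auto
    have av: "a_vec n $ Suc k = - ((- 1) ^ k)" if "Suc k < n" for k
      using that by (simp add: a_vec_def minus_one_power_iff)
    have dv: "dim_vec (v_vec n) = n - 1"
      by (simp add: v_vec_def)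
    have lt: "i' < n - 1" "j' < n - 1" "0 < n - 1"
      using i'j' ij by auto
    have "circ (v_vec n) $$ (i', j') = (- 1) ^ ((j' + (n - 1) - i') mod (n - 1))"
      by (simp only: circ_index dv lt) (simp only: v_vec_alt index_vec mod_less_divisor lt)
    also have "\<dots> = (- 1) ^ j' * (- 1) ^ i'"
      using lt that by (intro minus_one_power_mod_sub) auto
    finally show ?thesis
      using ij i'j' by (simp add: av bordered_mat_index dv)
  qed
  finally show "(col_mat (a_vec n) * transpose_mat (col_mat (a_vec n))) $$ (i, j) =
      bordered_mat 0 0 (circ (v_vec n)) $$ (i, j)" .
qed (use that in \<open>auto simp: col_mat_def a_vec_def v_vec_def elim: oddE\<close>)

section \<open>Assembly of the inverse and the pseudoinverse\<close>

theorem theorem5p6: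
  fixes n :: nat and D M :: "real mat" and a v z :: "real vec"
  assumes "n \<ge> 5" and "odd n"
    and "D = distance_matrix n (wheel n)"
    and "a = a_vec n" and "v = v_vec n" and "z = z_vec n"
    and "M = D + col_mat a * transpose_mat (col_mat a)"
  shows "invertible_mat M \<and>
    (let B = (1 / (real n - 1) ^ 2) \<cdot>\<^sub>m
               bordered_mat (- 2 * (real n - 1) * (real n - 3)) (real n - 1) (circ z)
     in inverts_mat M B \<and> inverts_mat B M) \<and>
    pinv D = (1 / (real n - 1) ^ 2) \<cdot>\<^sub>m
               bordered_mat (- 2 * (real n - 1) * (real n - 3)) (real n - 1) (circ (z - v))"
proof -
  obtain N where nN: "n = Suc N" using assms(1) by (cases n) auto
  then have N: "even N" "4 \<le> N" "0 < N" using assms(1,2) by auto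
  define P where "P = bordered_mat 0 0 (circ v)"
  define Z where "Z = bordered_mat (- 2 * (real n - 1) * (real n - 3)) (real n - 1) (circ z)"
  define B where "B = (1 / (real N)\<^sup>2) \<cdot>\<^sub>m Z"
  have v: "v = vec N (\<lambda>i. (- 1) ^ i)"
    using assms(5) nN by (simp add: v_vec_alt)
  have dims [simp]: "dim_vec (u_vec N) = N" "dim_vec v = N" "dim_vec z = N"
    by (auto simp: u_vec_def v assms(6) z_vec_def nN)
  have D: "D = bordered_mat 0 1 (circ (u_vec N))"
    using distance_matrix_wheel[OF assms(1)] by (simp add: assms(3) nN u_vec_def cong: if_cong)
  have M: "M = D + P"
    using outer_a_vec[OF assms(2)] assms(4,5,7) by (simp add: P_def)
  have sum_v: "(\<Sum>k<N. v $ k) = 0"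
    using N by (simp add: v sum_minus_one_power_even)
  have sum_z: "(\<Sum>k<N. z $ k) = 0"
    using N by (simp add: sum_z_vec assms(6) nN)
  have sum_u: "(\<Sum>k<N. u_vec N $ k) = 2 * real N - 4"
  proof -
    have "(\<Sum>k<N. u_vec N $ k) = (\<Sum>k<N. 2 - (if k = 0 then 2 else 0) - (if k = 1 then 1 else 0)
        - (if k = N - 1 then 1 else 0))"
      using N by (intro sum.cong) (auto simp: u_vec_def)
    then show ?thesis using N by (simp add: sum_subtractf)
  qed
  \<comment> \<open>The scaling factor is the sum of squares of \<open>v\<close>; it becomes the
    scalar \<open>c\<close> of \<open>pinv_eq_of_complement\<close>.\<close>
  have cvv: "cconv v v $ l = (real N \<cdot>\<^sub>v v) $ l" if "l < N" for l
    using that N cconv_alternating[of N v l]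
    by (simp add: v flip: power_add)
  \<comment> \<open>Both cyclic neighbours of an entry of \<open>v\<close> are its negative, so the
    weights -2, -1, -1 cancel.\<close>
  have cuv: "cconv (u_vec N) v $ l = 0" if "l < N" for l
  proof -
    have "v $ (if l = 0 then N - 1 else l - 1) = - v $ l"
      using that N by (cases l) (auto simp: v)
    moreover have "v $ (if Suc l = N then 0 else Suc l) = - v $ l"
      using that N by (auto simp: v)
    ultimately show ?thesis
      using that N by (subst cconv_u_vec) (simp_all add: sum_v)
  qed
  have cvu: "cconv v (u_vec N) $ l = 0" if "l < N" for l
    using cuv[OF that] by (simp add: cconv_commute[of v])
  \<comment> \<open>The contribution (-1)^l N of \<open>v\<close> cancels the alternating term of
    \<open>cconv_u_vec_z_vec\<close>. The remaining -N is absorbed later by the product of the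
    borders 1 and N.\<close>
  have cmz: "cconv (u_vec N + v) z $ l = (if l = 0 then (real N)\<^sup>2 else 0) - real N" if "l < N" for l
  proof -
    have "cconv (u_vec N + v) z $ l = cconv (u_vec N) z $ l + cconv v z $ l"
      using that by (simp add: cconv_def distrib_right sum.distrib)
    then show ?thesis
      using that N cconv_alternating[of N z l] sum_alternating_z_vec[of N]
      by (simp add: v assms(6) nN cconv_u_vec_z_vec)
  qed
  have Pc: "P \<in> carrier_mat n n" and Dc: "D \<in> carrier_mat n n" and Zc: "Z \<in> carrier_mat n n"
    and Bc: "B \<in> carrier_mat n n"
    by (auto simp: P_def D B_def Z_def nN carrier_matI)
  have DP: "D * P = 0\<^sub>m n n"
    unfolding D P_def nN bordered_mat_circ_zero[symmetric]
    by (rule bordered_mat_circ_mult) (auto simp: sum_v cuv)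
  have PD: "P * D = 0\<^sub>m n n"
    unfolding D P_def nN bordered_mat_circ_zero[symmetric]
    by (rule bordered_mat_circ_mult) (auto simp: sum_v cvu)
  have PP: "P * P = real N \<cdot>\<^sub>m P"
    unfolding P_def bordered_mat_circ_smult
    by (rule bordered_mat_circ_mult) (auto simp: sum_v cvv)
  have sym: "transpose_mat P = P"
    unfolding P_def assms(5) outer_a_vec[OF assms(2), symmetric]
    by (subst transpose_mult) (auto simp: col_mat_def)
  have M': "D + P = bordered_mat 0 1 (circ (u_vec N + v))"
    unfolding D P_def by (simp add: bordered_mat_circ_add)
  \<comment> \<open>The condition \<open>col\<close> explains the corner of \<open>Z\<close>: -2 N
    (N - 2) cancels the border N times the row sum 2 N - 4 of the inner block.\<close>
  have "(D + P) * Z = (real N)\<^sup>2 \<cdot>\<^sub>m 1\<^sub>m n"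
    unfolding M' Z_def nN bordered_mat_circ_one[symmetric]
    by (rule bordered_mat_circ_mult)
      (auto simp: cmz sum.distrib sum_u sum_v sum_z power2_eq_square algebra_simps)
  moreover have "(D + P) * B = (1 / (real N)\<^sup>2) \<cdot>\<^sub>m ((D + P) * Z)"
    unfolding B_def using Pc Dc Zc by (intro mult_smult_distrib) auto
  moreover have "(1 / (real N)\<^sup>2) \<cdot>\<^sub>m ((real N)\<^sup>2 \<cdot>\<^sub>m 1\<^sub>m n) = 1\<^sub>m n"
    using N(3) by (intro eq_matI) auto
  ultimately have MB: "(D + P) * B = 1\<^sub>m n"
    by simp
  have BM: "B * (D + P) = 1\<^sub>m n"
    using Pc Dc by (intro mat_mult_left_right_inverse[OF _ Bc MB]) auto
  have inv: "inverts_mat M B \<and> inverts_mat B M"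
    using MB BM Bc Pc Dc by (simp add: inverts_mat_def M)
  then have "invertible_mat M"
    using Pc Dc by (auto simp: invertible_mat_def M)
  moreover have "pinv D = (1 / (real N)\<^sup>2) \<cdot>\<^sub>m (Z - P)"
  proof -
    have "pinv D = B - (1 / (real N)\<^sup>2) \<cdot>\<^sub>m P"
      using N by (intro pinv_eq_of_complement[OF Dc Pc Bc DP PD PP _ sym MB BM]) auto
    also have "\<dots> = (1 / (real N)\<^sup>2) \<cdot>\<^sub>m (Z - P)"
      by (rule eq_matI) (use Pc in \<open>auto simp: B_def Z_def nN right_diff_distrib diff_divide_distrib\<close>)
    finally show ?thesis .
  qed
  moreover have "Z - P = bordered_mat (- 2 * (real n - 1) * (real n - 3)) (real n - 1) (circ (z - v))"
    unfolding Z_def P_def by (simp add: bordered_mat_circ_diff)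
  ultimately show ?thesis
    using inv unfolding B_def Z_def nN Let_def by simp
qed

end
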